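(* For any $s,t\in\mathbb N$ and $\varepsilon>0$ there exist $n_0=n_{\varepsilon,s,t}$ and $\delta>0$ such that any $\mathcal F\subseteq 2^{[n]}$ of size at least $(2+\varepsilon)\binom{n}{\lfloor n/2\rfloor}$ with $n\ge n_0$ contains at least $\delta n^{s+t}\binom{n}{\lfloor n/2\rfloor}$ induced copies of $K_{s,1,t}$.
   Context: For a finite poset $(P,\le)$ and $\mathcal F\subseteq 2^{[n]}$, an induced copy of $P$ in $\mathcal F$ is a subfamily $\mathcal G\subseteq\mathcal F$ with a bijection $i:P\to\mathcal G$ such that for all $p,q\in P$, $p\le q$ if and only if $i(p)\subseteq i(q)$. $K_{s,1,t}$ is the poset on elements $a_1,\dots,a_s,b,c_1,\dots,c_t$ where $a_j<b<c_k$ for all $j,k$ (hence $a_j<c_k$), and the $a_j$ are pairwise incomparable and the $c_k$ are pairwise incomparable. *)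

theory Defs
  imports Complex_Main
begin

text \<open>A poset is given by a carrier \<^term>\<open>P\<close> and an order relation \<^term>\<open>r\<close> on it
  (\<^prop>\<open>partial_order_on P r\<close>). A copy is the subfamily itself, not the bijection onto it, so
  counting copies does not distinguish embeddings with the same image.\<close>

definition induced_copies :: "'p set \<Rightarrow> 'p rel \<Rightarrow> 'a set set \<Rightarrow> 'a set set set" where
  "induced_copies P r F =
     {G. G \<subseteq> F \<and>
        (\<exists>i. bij_betw i P G \<and> (\<forall>p\<in>P. \<forall>q\<in>P. (p, q) \<in> r \<longleftrightarrow> i p \<subseteq> i q))}"

datatype K_elem = Bot nat | Mid | Top nat

fun K_less :: "K_elem \<Rightarrow> K_elem \<Rightarrow> bool" where
  "K_less (Bot _) Mid = True"
| "K_less (Bot _) (Top _) = True"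
| "K_less Mid (Top _) = True"
| "K_less _ _ = False"

definition K_carrier :: "nat \<Rightarrow> nat \<Rightarrow> K_elem set" where
  "K_carrier s t = Bot ` {1..s} \<union> {Mid} \<union> Top ` {1..t}"

definition K_order :: "nat \<Rightarrow> nat \<Rightarrow> K_elem rel" where
  "K_order s t = {(p, q). p \<in> K_carrier s t \<and> q \<in> K_carrier s t \<and> (p = q \<or> K_less p q)}"

lemma finite_K_carrier: "finite (K_carrier s t)"
  by (simp add: K_carrier_def)

lemma partial_order_on_K: "partial_order_on (K_carrier s t) (K_order s t)"
proof -
  have asym: "K_less p q \<Longrightarrow> \<not> K_less q p" for p q
    by (cases p; cases q) auto
  have tr: "K_less p q \<Longrightarrow> K_less q r \<Longrightarrow> K_less p r" for p q r
    by (cases p; cases q; cases r) auto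
  show ?thesis
    unfolding partial_order_on_def preorder_on_def
    by (auto simp: refl_on_def trans_def antisym_def K_order_def dest: asym tr)
qed

end

theory Submission
  imports Defs "HOL-Probability.Hoeffding" "HOL-Real_Asymp.Real_Asymp"
begin

text \<open>Discard the few sets of size outside \<open>[k, n - k]\<close> with \<open>k\<close> slightly below \<open>n/2\<close>. Call a remaining
  member \<open>M\<close> bad from below if a random maximal chain from the empty set to \<open>M\<close> meets the family
  before \<open>M\<close> with probability at most \<open>\<eta>\<close>. The number of bad sets on a random full chain has
  expectation \<open>\<lambda> \<le> 1 + \<eta> \<lambda>\<close>, since those after the first contribute at most \<open>\<eta> \<lambda>\<close>; hence there are at
  most \<open>1 / (1 - \<eta>)\<close> times the central binomial coefficient of them. The same holds from above by
  complementation, so at least a constant times the central binomial coefficient of the members are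
  good on both sides.

  Below a good \<open>M\<close>, a random chain meets a set comparable to one of fewer than \<open>s\<close> prescribed members
  only with small probability, because all sizes lie in a narrow window; and each set is met with
  probability at most \<open>1 / |M|\<close>. So an antichain below \<open>M\<close> can be extended in linearly many ways
  until it has \<open>s\<close> elements, and likewise above \<open>M\<close>.\<close>

section \<open>Hitting probabilities of a random maximal chain\<close>

text \<open>The probability that a uniformly random maximal chain of \<^term>\<open>Pow M\<close> meets \<^term>\<open>D\<close>, computed
  by descending from \<^term>\<open>M\<close>. For infinite \<^term>\<open>M\<close> outside \<^term>\<open>D\<close> the value is \<open>0\<close>.\<close>

function hit_prob :: "'a set set \<Rightarrow> 'a set \<Rightarrow> real" where
  "hit_prob D M = (if M \<in> D then 1 else if finite M
     then (\<Sum>x\<in>M. hit_prob D (M - {x})) / real (card M) else 0)"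
  by auto
termination
  by (relation "Wellfounded.measure (\<lambda>(D, M). card M)") (auto simp: card_gt_0_iff intro!: diff_less)

declare hit_prob.simps [simp del]

lemma hit_prob_self: "M \<in> D \<Longrightarrow> hit_prob D M = 1"
  by (simp add: hit_prob.simps)

lemma hit_prob_step:
  "finite M \<Longrightarrow> M \<notin> D \<Longrightarrow> hit_prob D M = (\<Sum>x\<in>M. hit_prob D (M - {x})) / real (card M)"
  by (subst hit_prob.simps) simp

lemma average_le:
  assumes "\<And>x. x \<in> M \<Longrightarrow> f x \<le> (c::real)" "0 \<le> c"
  shows "(\<Sum>x\<in>M. f x) / real (card M) \<le> c"
\<comment> \<open>For empty or infinite \<open>M\<close> the quotient is a division by 0, hence 0,
  which \<open>0 \<le> c\<close> covers.\<close>
proof (cases "card M = 0")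
  case False
  have "(\<Sum>x\<in>M. f x) \<le> real (card M) * c"
    using sum_bounded_above[of M f c] assms(1) by simp
  with False show ?thesis by (simp add: field_simps)
qed (use assms in simp)

lemma hit_prob_nonneg: "finite M \<Longrightarrow> 0 \<le> hit_prob D M"
proof (induction M rule: finite_psubset_induct)
  case (psubset M)
  then show ?case
    by (cases "M \<in> D")
      (auto simp: hit_prob_self hit_prob_step intro!: divide_nonneg_nonneg sum_nonneg)
qed

lemma hit_prob_le_1: "finite M \<Longrightarrow> hit_prob D M \<le> 1"
proof (induction M rule: finite_psubset_induct)
  case (psubset M)
  then show ?case
    by (cases "M \<in> D") (auto simp: hit_prob_self hit_prob_step intro!: average_le)
qed

lemma hit_prob_mono:
  assumes "finite M" "\<And>B. B \<subseteq> M \<Longrightarrow> B \<in> D \<Longrightarrow> B \<in> D'"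
  shows "hit_prob D M \<le> hit_prob D' M"
  using assms
proof (induction M rule: finite_psubset_induct)
  case (psubset M)
  show ?case
  proof (cases "M \<in> D'")
    case True
    then show ?thesis by (simp add: hit_prob_self hit_prob_le_1 psubset.hyps)
  next
    case False
    with psubset.prems have "M \<notin> D" by auto
    moreover have "hit_prob D (M - {x}) \<le> hit_prob D' (M - {x})" if "x \<in> M" for x
      using that by (intro psubset.IH psubset.prems) auto
    ultimately show ?thesis
      using False psubset.hyps by (auto simp: hit_prob_step intro!: divide_right_mono sum_mono)
  qed
qed

lemma hit_prob_cong:
  assumes "finite M" "\<And>B. B \<subseteq> M \<Longrightarrow> B \<in> D \<longleftrightarrow> B \<in> D'"
  shows "hit_prob D M = hit_prob D' M"
  using assms by (intro antisym hit_prob_mono) auto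

lemma hit_prob_empty: "finite M \<Longrightarrow> hit_prob {} M = 0"
proof (induction M rule: finite_psubset_induct)
  case (psubset M)
  have "(\<Sum>x\<in>M. hit_prob {} (M - {x})) = 0"
    by (intro sum.neutral ballI psubset.IH) auto
  with psubset.hyps show ?case by (subst hit_prob_step) auto
qed

lemma hit_prob_Un:
  assumes "finite M"
  shows "hit_prob (D \<union> D') M \<le> hit_prob D M + hit_prob D' M"
  using assms
proof (induction M rule: finite_psubset_induct)
  case (psubset M)
  show ?case
  proof (cases "M \<in> D \<union> D'")
    case True
    then show ?thesis
      using hit_prob_nonneg[OF psubset.hyps, of D] hit_prob_nonneg[OF psubset.hyps, of D']
      by (auto simp: hit_prob_self)
  next
    case False
    have "(\<Sum>x\<in>M. hit_prob (D \<union> D') (M - {x}))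
        \<le> (\<Sum>x\<in>M. hit_prob D (M - {x}) + hit_prob D' (M - {x}))"
      by (intro sum_mono psubset.IH) auto
    with False psubset.hyps show ?thesis
      by (auto simp: hit_prob_step sum.distrib add_divide_distrib [symmetric] intro!: divide_right_mono)
  qed
qed

lemma hit_prob_UN:
  assumes "finite M" "finite S"
  shows "hit_prob (\<Union>A\<in>S. D A) M \<le> (\<Sum>A\<in>S. hit_prob (D A) M)"
  using assms(2)
proof (induction S)
  case (insert A S)
  then show ?case
    using hit_prob_Un[OF assms(1), of "D A" "\<Union>A\<in>S. D A"] by simp
qed (simp add: hit_prob_empty assms)

text \<open>If the first element removed from \<open>M\<close> lies in \<open>A\<close>, no later
  set contains \<open>A\<close>, so the chain misses \<open>D\<close>. The bound is the probability
  that the first removed element lies outside \<open>A\<close>.\<close>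

lemma hit_prob_above:
  assumes "finite M" "A \<subseteq> M" "M \<notin> D" "\<And>B. B \<in> D \<Longrightarrow> A \<subseteq> B"
  shows "hit_prob D M \<le> real (card M - card A) / real (card M)"
proof -
  have "hit_prob D (M - {x}) \<le> (if x \<in> M - A then 1 else 0)" if "x \<in> M" for x
  proof (cases "x \<in> A")
    case True
    then have "hit_prob D (M - {x}) = hit_prob {} (M - {x})"
      using assms by (intro hit_prob_cong) auto
    with True assms show ?thesis by (simp add: hit_prob_empty)
  qed (use that assms in \<open>simp add: hit_prob_le_1\<close>)
  then have "(\<Sum>x\<in>M. hit_prob D (M - {x})) \<le> (\<Sum>x\<in>M. if x \<in> M - A then 1 else 0)"
    by (intro sum_mono)
  also have "\<dots> = real (card (M - A))"
    using assms(1) by (subst sum.inter_restrict [symmetric]) (simp_all add: Int_absorb1)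
  also have "\<dots> = real (card M - card A)"
    using assms by (simp add: card_Diff_subset finite_subset)
  finally show ?thesis
    using assms by (auto simp: hit_prob_step intro!: divide_right_mono)
qed

text \<open>To meet \<open>D\<close> the chain must drop \<open>x\<close> within its first
  \<open>card M - k\<close> removals, and the position of \<open>x\<close> in the removal order is
  uniform. The induction conditions on the first removal: either it is \<open>x\<close>, where the
  trivial bound 1 is used, or the bound for \<open>card M - 1\<close> applies.\<close>

lemma hit_prob_avoiding:
  assumes "finite M" "x \<in> M" "\<And>B. B \<in> D \<Longrightarrow> x \<notin> B \<and> k \<le> card B"
  shows "hit_prob D M \<le> real (card M - k) / real (card M)"
  using assms(1,2)
proof (induction M rule: finite_psubset_induct)
  case (psubset M)
  have "M \<notin> D" using assms(3) psubset.prems by auto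
  show ?case
  proof (cases "card M \<le> k")
    case True
    \<comment> \<open>The only subset of \<open>M\<close> that could be large enough is
      \<open>M\<close> itself, which contains \<open>x\<close>.\<close>
    have "hit_prob D M = hit_prob {} M"
    proof (rule hit_prob_cong)
      fix B assume "B \<subseteq> M"
      then have "B \<in> D \<Longrightarrow> B = M"
        using assms(3)[of B] True psubset.hyps card_seteq[of M B] by linarith
      with \<open>M \<notin> D\<close> show "B \<in> D \<longleftrightarrow> B \<in> {}" by auto
    qed (rule psubset.hyps)
    with True psubset.hyps show ?thesis by (simp add: hit_prob_empty)
  next
    case False
    let ?m = "card M"
    have "hit_prob D (M - {y}) \<le> real (?m - 1 - k) / real (?m - 1)" if "y \<in> M - {x}" for y
      using psubset.IH[of "M - {y}"] that psubset.prems psubset.hyps by auto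
    then have "(\<Sum>y\<in>M - {x}. hit_prob D (M - {y})) \<le> real (card (M - {x})) * (real (?m - 1 - k) / real (?m - 1))"
      by (intro sum_bounded_above)
    also have "\<dots> = real (?m - 1 - k)"
      using psubset.hyps psubset.prems by (cases "?m - 1 = 0") auto
    finally have "(\<Sum>y\<in>M. hit_prob D (M - {y})) \<le> 1 + real (?m - 1 - k)"
      using hit_prob_le_1[of "M - {x}" D] psubset.hyps psubset.prems
      by (simp add: sum.remove[of M x])
    also have "\<dots> = real (?m - k)" using False by simp
    finally show ?thesis
      unfolding hit_prob_step[OF psubset.hyps \<open>M \<notin> D\<close>] by (intro divide_right_mono) auto
  qed
qed

section \<open>Expected number of members on a chain, and the bound on bad sets\<close>

text \<open>The expected number of members of \<^term>\<open>D\<close> on a random maximal chain of \<^term>\<open>Pow M\<close>.\<close>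

definition lubell :: "'a set set \<Rightarrow> 'a set \<Rightarrow> real" where
  "lubell D M = (\<Sum>B\<in>{B \<in> D. B \<subseteq> M}. 1 / real (card M choose card B))"

text \<open>This is the recursion of \<open>hit_prob\<close> with the contribution of
  \<open>M\<close> added instead of stopping there, so that the two quantities can be compared by
  the same induction. A proper subset \<open>B\<close> survives the removal of exactly
  \<open>card M - card B\<close> elements, and the absorption identity for binomials restores its
  weight.\<close>

lemma lubell_step:
  assumes "finite M"
  shows "lubell D M = (if M \<in> D then 1 else 0) + (\<Sum>x\<in>M. lubell D (M - {x})) / real (card M)"
proof -
  let ?m = "card M" and ?P = "{B \<in> D. B \<subset> M}"
  have fin: "finite {B \<in> D. B \<subseteq> M}"
    using assms by simp
  then have "finite ?P"
    by (rule rev_finite_subset) auto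
  note fin = fin this
  have "(\<Sum>x\<in>M. lubell D (M - {x}))
      = (\<Sum>x\<in>M. \<Sum>B\<in>{B \<in> ?P. x \<notin> B}. 1 / real (?m - 1 choose card B))"
    unfolding lubell_def using assms by (intro sum.cong) auto
  also have "\<dots> = (\<Sum>B\<in>?P. \<Sum>x\<in>{x \<in> M. x \<notin> B}. 1 / real (?m - 1 choose card B))"
    using assms fin by (intro sum.swap_restrict) auto
  also have "\<dots> = (\<Sum>B\<in>?P. real ?m / real (?m choose card B))"
  proof (intro sum.cong refl)
    fix B assume "B \<in> ?P"
    then have B: "B \<subset> M" by auto
    then have lt: "card B < ?m" using assms psubset_card_mono by auto
    have "card {x \<in> M. x \<notin> B} = ?m - card B"
      using B assms by (subst card_Diff_subset [symmetric]) (auto intro: finite_subset arg_cong[where f = card])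
    moreover have "(?m - card B) * (?m choose card B) = ?m * (?m - 1 choose card B)"
      by (rule binomial_absorb_comp)
    then have "real (?m - card B) * real (?m choose card B) = real ?m * real (?m - 1 choose card B)"
      by (metis of_nat_mult)
    ultimately show "(\<Sum>x\<in>{x \<in> M. x \<notin> B}. 1 / real (?m - 1 choose card B)) = real ?m / real (?m choose card B)"
      using lt by (auto simp: field_simps)
  qed
  finally have "(\<Sum>x\<in>M. lubell D (M - {x})) / real ?m = (\<Sum>B\<in>?P. real ?m / real (?m choose card B)) / real ?m"
    by simp
  also have "\<dots> = (\<Sum>B\<in>?P. 1 / real (?m choose card B))"
  proof (cases "?m = 0")
    case True
    then have "M = {}" using assms by simp
    then have "?P = {}" by blast
    then show ?thesis by (simp only: sum.empty div_0)
  qed (simp add: sum_divide_distrib)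
  finally have eq: "(\<Sum>x\<in>M. lubell D (M - {x})) / real ?m = (\<Sum>B\<in>?P. 1 / real (?m choose card B))" .
  have "{B \<in> D. B \<subseteq> M} = (if M \<in> D then insert M ?P else ?P)" by auto
  then show ?thesis unfolding eq unfolding lubell_def using fin by auto
qed

lemma hit_prob_le_lubell:
  assumes "finite M"
  shows "hit_prob D M \<le> lubell D M"
  using assms
proof (induction M rule: finite_psubset_induct)
  case (psubset M)
  have nn: "0 \<le> lubell D N" for N :: "'a set"
    unfolding lubell_def by (intro sum_nonneg) auto
  have "(\<Sum>x\<in>M. hit_prob D (M - {x})) / real (card M) \<le> (\<Sum>x\<in>M. lubell D (M - {x})) / real (card M)"
    by (intro divide_right_mono sum_mono psubset.IH) auto
  moreover have "0 \<le> (\<Sum>x\<in>M. lubell D (M - {x})) / real (card M)"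
    by (intro divide_nonneg_nonneg sum_nonneg nn) auto
  ultimately show ?case
    using hit_prob_step[OF psubset.hyps, of D]
    unfolding lubell_step[OF psubset.hyps, of D] by (cases "M \<in> D") (simp_all add: hit_prob_self)
qed

text \<open>Let \<open>B\<close> be the first member met by the descending chain. By induction the
  expected number of later members, times \<open>1 - \<eta>\<close>, is at most the probability of
  meeting another one, which is at most \<eta>. Together with \<open>B\<close> itself this gives at
  most \<open>(1 - \<eta>) + \<eta> = 1\<close>, the value of \<open>hit_prob\<close> at
  \<open>B\<close>.\<close>

lemma lubell_le_hit_prob:
  assumes "finite M" "\<And>B. B \<in> A \<Longrightarrow> hit_prob (A - {B}) B \<le> \<eta>"
  shows "(1 - \<eta>) * lubell A M \<le> hit_prob A M"
  using assms(1)
proof (induction M rule: finite_psubset_induct)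
  case (psubset M)
  let ?h = "(\<Sum>x\<in>M. hit_prob A (M - {x})) / real (card M)"
  have "(\<Sum>x\<in>M. (1 - \<eta>) * lubell A (M - {x})) / real (card M) \<le> ?h"
    by (intro divide_right_mono sum_mono psubset.IH) auto
  then have le: "(1 - \<eta>) * ((\<Sum>x\<in>M. lubell A (M - {x})) / real (card M)) \<le> ?h"
    by (simp add: sum_distrib_left)
  show ?case
  proof (cases "M \<in> A")
    case True
    have "(\<Sum>x\<in>M. hit_prob A (M - {x})) = (\<Sum>x\<in>M. hit_prob (A - {M}) (M - {x}))"
      using psubset.hyps by (intro sum.cong hit_prob_cong) auto
    then have "?h = hit_prob (A - {M}) M"
      using psubset.hyps by (simp add: hit_prob_step)
    with assms(2)[OF True] have "?h \<le> \<eta>" by simp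
    moreover have "lubell A M = 1 + (\<Sum>x\<in>M. lubell A (M - {x})) / real (card M)"
      using True by (subst lubell_step[OF psubset.hyps]) simp
    ultimately show ?thesis
      using le True by (simp add: distrib_left hit_prob_self)
  next
    case False
    with le show ?thesis
      unfolding lubell_step[OF psubset.hyps] hit_prob_step[OF psubset.hyps False] by simp
  qed
qed

text \<open>As in the LYM inequality, each member weighs at least the reciprocal of the central
  binomial coefficient.\<close>

lemma card_le_lubell:
  assumes "finite M" "A \<subseteq> Pow M"
  shows "real (card A) \<le> lubell A M * real (card M choose (card M div 2))"
proof -
  let ?C = "card M choose (card M div 2)"
  have "real (card A) = (\<Sum>B\<in>A. 1)" by simp
  also have "\<dots> \<le> (\<Sum>B\<in>A. 1 / real (card M choose card B) * real ?C)"
  proof (rule sum_mono)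
    fix B assume "B \<in> A"
    then have "card B \<le> card M" using assms by (auto intro: card_mono)
    then have "0 < card M choose card B" by simp
    moreover have "card M choose card B \<le> ?C" by (rule binomial_maximum)
    ultimately show "1 \<le> 1 / real (card M choose card B) * real ?C" by (simp add: field_simps)
  qed
  also have "\<dots> = lubell A M * real ?C"
    using assms(2) by (auto simp: lubell_def sum_distrib_right intro!: sum.cong)
  finally show ?thesis .
qed

text \<open>It bounds by \<open>1 / m\<close> the probability that a chain in an
  \<open>m\<close>-set passes through a given proper nonempty subset.\<close>

lemma binomial_ge_self: "0 < j \<Longrightarrow> j < m \<Longrightarrow> m \<le> m choose j"
proof (induction m arbitrary: j)
  case (Suc m)
  then obtain i where j: "j = Suc i" by (cases j) auto
  show ?case
  proof (cases "j = m")
    case False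
    with Suc j have "m \<le> m choose Suc i" "i \<le> m" by auto
    then show ?thesis using Suc_leI[OF zero_less_binomial[of i m]] by (simp add: j)
  qed simp
qed simp

text \<open>A bad set meets other bad sets no more often than other members of \<open>F\<close>, so
  the family of bad sets alone satisfies the hypothesis of
  \<open>lubell_le_hit_prob\<close>.\<close>

lemma card_bad_le:
  assumes "finite U" "F \<subseteq> Pow U"
  shows "(1 - \<eta>) * real (card {M \<in> F. hit_prob (F - {M}) M \<le> \<eta>})
      \<le> real (card U choose (card U div 2))"
proof (cases "\<eta> \<le> 1")
  case True
  let ?A = "{M \<in> F. hit_prob (F - {M}) M \<le> \<eta>}" and ?C = "real (card U choose (card U div 2))"
  have "hit_prob (?A - {M}) M \<le> \<eta>" if "M \<in> ?A" for M
  proof -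
    have "finite M" using that assms by (auto intro: rev_finite_subset)
    then have "hit_prob (?A - {M}) M \<le> hit_prob (F - {M}) M"
      by (intro hit_prob_mono) auto
    with that show ?thesis by auto
  qed
  then have "(1 - \<eta>) * lubell ?A U \<le> 1"
    by (rule order.trans[OF lubell_le_hit_prob[OF assms(1)] hit_prob_le_1[OF assms(1)]])
  then have "(1 - \<eta>) * lubell ?A U * ?C \<le> 1 * ?C"
    by (intro mult_right_mono) auto
  moreover have "(1 - \<eta>) * real (card ?A) \<le> (1 - \<eta>) * (lubell ?A U * ?C)"
    using True assms by (intro mult_left_mono card_le_lubell) auto
  ultimately show ?thesis by (simp only: mult.assoc mult_1)
next
  case False
  then show ?thesis by (intro order.trans[OF mult_nonpos_nonneg]) auto
qed

section \<open>Antichains below and above a good member\<close>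

definition incomparable :: "'a set \<Rightarrow> 'a set \<Rightarrow> bool" where
  "incomparable A B \<longleftrightarrow> \<not> A \<subseteq> B \<and> \<not> B \<subseteq> A"

definition antichains :: "'a set set \<Rightarrow> nat \<Rightarrow> 'a set set set" where
  "antichains D s = {S. S \<subseteq> D \<and> card S = s \<and> pairwise incomparable S}"

lemma finite_antichains: "finite D \<Longrightarrow> finite (antichains D s)"
  unfolding antichains_def by (rule finite_subset[of _ "Pow D"]) auto

text \<open>A chain meeting \<open>D\<close> meets either a set comparable to some \<open>A\<close>
  in \<open>S\<close>, with probability at most \<open>2 * (card M - k) / card M\<close> for each
  \<open>A\<close>, or a set incomparable to all of \<open>S\<close>. Each set of the latter kind is
  proper and, by \<open>0 < k\<close>, nonempty, so it is met with probability at most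
  \<open>1 / card M\<close>; hence there must be many.\<close>

lemma card_incomparable_ge:
  assumes "finite M" "\<And>B. B \<in> D \<Longrightarrow> B \<subset> M \<and> k \<le> card B" "0 < k" "S \<subseteq> D"
  shows "hit_prob D M * real (card M)
      \<le> real (card {B \<in> D. \<forall>A\<in>S. incomparable A B}) + 2 * real (card S) * real (card M - k)"
proof (cases "card M = 0")
  case False
  let ?I = "{B \<in> D. \<forall>A\<in>S. incomparable A B}" and ?m = "real (card M)"
  let ?U = "\<lambda>A. {B \<in> D. A \<subseteq> B}" and ?L = "\<lambda>A. {B \<in> D. B \<subseteq> A}"
  have "finite D" using assms by (intro finite_subset[of D "Pow M"]) auto
  then have finS: "finite S" using assms finite_subset by auto
  have "M \<notin> D" using assms(2) by auto
  have comp: "hit_prob (?U A \<union> ?L A) M \<le> 2 * (real (card M - k) / ?m)" if "A \<in> S" for A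
  proof -
    have A: "A \<subset> M" "k \<le> card A" using that assms by auto
    \<comment> \<open>All members of \<open>D\<close> inside \<open>A\<close> avoid this
      \<open>x\<close>, which is how \<open>hit_prob_avoiding\<close> applies to
      \<open>?L A\<close>.\<close>
    then obtain x where x: "x \<in> M" "x \<notin> A" by auto
    have "hit_prob (?U A) M \<le> real (card M - card A) / ?m"
      using A assms(1) \<open>M \<notin> D\<close> by (intro hit_prob_above) auto
    also have "\<dots> \<le> real (card M - k) / ?m"
      using A by (intro divide_right_mono) auto
    finally have "hit_prob (?U A) M \<le> real (card M - k) / ?m" .
    moreover have "hit_prob (?L A) M \<le> real (card M - k) / ?m"
      using x assms by (intro hit_prob_avoiding[where x = x]) auto
    ultimately show ?thesis using hit_prob_Un[OF assms(1), of "?U A" "?L A"] by linarith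
  qed
  have "hit_prob D M \<le> hit_prob (?I \<union> (\<Union>A\<in>S. ?U A \<union> ?L A)) M"
    using assms(1) by (intro hit_prob_mono) (auto simp: incomparable_def)
  also have "\<dots> \<le> hit_prob ?I M + hit_prob (\<Union>A\<in>S. ?U A \<union> ?L A) M"
    by (rule hit_prob_Un[OF assms(1)])
  also have "hit_prob (\<Union>A\<in>S. ?U A \<union> ?L A) M \<le> (\<Sum>A\<in>S. hit_prob (?U A \<union> ?L A) M)"
    by (rule hit_prob_UN[OF assms(1) finS])
  also have "\<dots> \<le> real (card S) * (2 * (real (card M - k) / ?m))"
    by (intro sum_bounded_above comp)
  also have "hit_prob ?I M \<le> lubell ?I M"
    by (rule hit_prob_le_lubell[OF assms(1)])
  also have "lubell ?I M \<le> real (card {B \<in> ?I. B \<subseteq> M}) * (1 / ?m)"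
    unfolding lubell_def
  proof (rule sum_bounded_above)
    fix B assume "B \<in> {B \<in> ?I. B \<subseteq> M}"
    then have "B \<subset> M" "k \<le> card B" using assms(2) by auto
    then have "0 < card B" "card B < card M"
      using assms(1,3) psubset_card_mono by auto
    then have "card M \<le> card M choose card B" by (rule binomial_ge_self)
    with False show "1 / real (card M choose card B) \<le> 1 / ?m"
      by (intro frac_le) auto
  qed
  also have "{B \<in> ?I. B \<subseteq> M} = ?I" using assms(2) by auto
  finally have "hit_prob D M \<le> real (card ?I) * (1 / ?m) + real (card S) * (2 * (real (card M - k) / ?m))"
    by simp
  with False show ?thesis by (simp add: field_simps)
qed simp

text \<open>Double counting: adding \<open>B\<close> to an antichain of size \<open>i\<close> gives
  one of size \<open>i + 1\<close> with a marked element, injectively, and a larger antichain can be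
  marked in \<open>i + 1\<close> ways. Iterating produces the factorial.\<close>

lemma card_antichains_ge:
  assumes "finite D" "0 \<le> c"
    and ext: "\<And>S. S \<subseteq> D \<Longrightarrow> card S < s \<Longrightarrow> c \<le> real (card {B \<in> D. \<forall>A\<in>S. incomparable A B})"
  shows "i \<le> s \<Longrightarrow> c ^ i \<le> fact i * real (card (antichains D i))"
proof (induction i)
  case 0
  have "antichains D 0 = {{}}"
    using assms(1) by (auto simp: antichains_def finite_subset)
  then show ?case by simp
next
  case (Suc i)
  define E where "E S = {B \<in> D. \<forall>A\<in>S. incomparable A B}" for S
  have fin: "finite (antichains D j)" for j
    using assms(1) by (rule finite_antichains)
  have finE: "finite (E S)" for S using assms(1) by (simp add: E_def)
  have finT: "finite T" if "T \<in> antichains D j" for T j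
    using that assms(1) by (auto simp: antichains_def intro: finite_subset)
  have "card (SIGMA S:antichains D i. E S) \<le> card (SIGMA T:antichains D (Suc i). T)"
  proof (rule card_inj_on_le)
    show "inj_on (\<lambda>(S, B). (insert B S, B)) (SIGMA S:antichains D i. E S)"
      using insert_ident by (fastforce simp: E_def incomparable_def intro!: inj_onI)
    show "(\<lambda>(S, B). (insert B S, B)) ` (SIGMA S:antichains D i. E S)
        \<subseteq> (SIGMA T:antichains D (Suc i). T)"
    proof (rule image_subsetI)
      fix z assume "z \<in> (SIGMA S:antichains D i. E S)"
      then obtain S B where z: "z = (S, B)" and S: "S \<in> antichains D i" and B: "B \<in> E S"
        by auto
      then have "B \<notin> S" by (auto simp: E_def incomparable_def)
      with S B finT[OF S] show "(\<lambda>(S, B). (insert B S, B)) z \<in> (SIGMA T:antichains D (Suc i). T)"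
        by (auto simp: z antichains_def E_def pairwise_insert incomparable_def)
    qed
    show "finite (SIGMA T:antichains D (Suc i). T)"
      using fin finT by (intro finite_SigmaI) auto
  qed
  also have "\<dots> = (\<Sum>T\<in>antichains D (Suc i). card T)"
    using fin finT by (intro card_SigmaI) auto
  also have "\<dots> = Suc i * card (antichains D (Suc i))"
    by (simp add: antichains_def)
  finally have "(\<Sum>S\<in>antichains D i. card (E S)) \<le> Suc i * card (antichains D (Suc i))"
    using fin finE by simp
  then have "(\<Sum>S\<in>antichains D i. real (card (E S))) \<le> real (Suc i) * real (card (antichains D (Suc i)))"
    by (metis of_nat_le_iff of_nat_mult of_nat_sum)
  moreover have "real (card (antichains D i)) * c \<le> (\<Sum>S\<in>antichains D i. real (card (E S)))"
    using Suc.prems by (intro sum_bounded_below) (auto simp: E_def antichains_def intro!: ext)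
  ultimately have *: "real (card (antichains D i)) * c \<le> real (Suc i) * real (card (antichains D (Suc i)))"
    by linarith
  have "c ^ Suc i \<le> c * (fact i * real (card (antichains D i)))"
    using Suc assms(2) by (auto intro: mult_left_mono)
  also have "\<dots> = fact i * (real (card (antichains D i)) * c)" by simp
  also have "\<dots> \<le> fact i * (real (Suc i) * real (card (antichains D (Suc i))))"
    using * by (intro mult_left_mono) auto
  finally show ?case by (simp add: algebra_simps)
qed

text \<open>The hypothesis \<open>thin\<close> limits the loss to sets comparable with the antichain
  built so far to half of \<open>\<eta> * card M\<close>, leaving the other half as possible
  extensions at every stage.\<close>

lemma many_antichains_below:
  assumes "finite M" "\<And>B. B \<in> F \<Longrightarrow> k \<le> card B" "0 < k" "0 \<le> \<eta>"
    and hit: "\<eta> \<le> hit_prob (F - {M}) M"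
    and thin: "4 * real s * real (card M - k) \<le> \<eta> * real (card M)"
  shows "(\<eta> * real (card M) / 2) ^ s \<le> fact s * real (card (antichains {B \<in> F. B \<subset> M} s))"
proof (rule card_antichains_ge[OF _ _ _ order.refl])
  let ?D = "{B \<in> F. B \<subset> M}"
  show "finite ?D" using assms(1) by (intro finite_subset[of ?D "Pow M"]) auto
  fix S assume S: "S \<subseteq> ?D" "card S < s"
  have "hit_prob (F - {M}) M = hit_prob ?D M"
    using assms(1) by (intro hit_prob_cong) auto
  with hit have "\<eta> * real (card M) \<le> hit_prob ?D M * real (card M)"
    by (intro mult_right_mono) auto
  also have "\<dots> \<le> real (card {B \<in> ?D. \<forall>A\<in>S. incomparable A B})
      + 2 * real (card S) * real (card M - k)"
    by (rule card_incomparable_ge[OF assms(1)]) (use assms(2,3) S(1) in auto)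
  finally have "\<eta> * real (card M) \<le> real (card {B \<in> ?D. \<forall>A\<in>S. incomparable A B})
      + 2 * real (card S) * real (card M - k)" .
  moreover have "2 * real (card S) * real (card M - k) \<le> 2 * real s * real (card M - k)"
    using S by (intro mult_right_mono) auto
  ultimately show "\<eta> * real (card M) / 2 \<le> real (card {B \<in> ?D. \<forall>A\<in>S. incomparable A B})"
    using thin by linarith
qed (use assms in auto)

text \<open>Complementation in \<open>U\<close> reverses inclusion and preserves incomparability, so
  counts below \<open>U - M\<close> carry over to counts above \<open>M\<close>.\<close>

lemma card_antichains_complement:
  assumes "finite U" "F \<subseteq> Pow U" "M \<subseteq> U"
  shows "card (antichains {B \<in> (-) U ` F. B \<subset> U - M} t) \<le> card (antichains {B \<in> F. M \<subset> B} t)"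
proof (rule card_inj_on_le)
  let ?X = "{B \<in> (-) U ` F. B \<subset> U - M}"
  have inj: "inj_on ((-) U) (Pow U)"
    by (rule inj_on_inverseI[where g = "(-) U"]) (simp add: double_diff)
  have XU: "?X \<subseteq> Pow U" by auto
  show "inj_on (image ((-) U)) (antichains ?X t)"
  proof (rule inj_onI)
    fix S S' assume *: "S \<in> antichains ?X t" "S' \<in> antichains ?X t" "(-) U ` S = (-) U ` S'"
    then have "S \<subseteq> ?X" "S' \<subseteq> ?X" unfolding antichains_def by blast+
    with XU have "S \<subseteq> Pow U" "S' \<subseteq> Pow U" by (blast dest: order.trans)+
    with *(3) show "S = S'" by (simp add: inj_on_image_eq_iff[OF inj])
  qed
  show "image ((-) U) ` antichains ?X t \<subseteq> antichains {B \<in> F. M \<subset> B} t"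
  proof clarify
    fix S assume "S \<in> antichains ?X t"
    then have S: "S \<subseteq> ?X" "card S = t" "pairwise incomparable S"
      by (simp_all add: antichains_def)
    have SU: "S \<subseteq> Pow U" using S(1) XU by (rule order.trans)
    have "card ((-) U ` S) = t"
      using S(2) card_image[OF inj_on_subset[OF inj SU]] by simp
    moreover have "(-) U ` S \<subseteq> {B \<in> F. M \<subset> B}"
    proof (rule image_subsetI)
      fix B assume "B \<in> S"
      with S(1) have "B \<in> ?X" by (rule subsetD)
      then obtain A where A: "A \<in> F" "B = U - A" "U - A \<subset> U - M" by force
      moreover have "A \<subseteq> U" using A(1) assms(2) by blast
      ultimately show "U - B \<in> {B \<in> F. M \<subset> B}"
        using assms(3) by (simp add: double_diff) blast
    qed
    moreover have "pairwise incomparable ((-) U ` S)"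
    proof (rule pairwiseI)
      fix A B assume AB: "A \<in> (-) U ` S" "B \<in> (-) U ` S" "A \<noteq> B"
      then obtain A' B' where *: "A' \<in> S" "B' \<in> S" "A = U - A'" "B = U - B'" by blast
      with AB(3) S(3) have "incomparable A' B'" unfolding pairwise_def by metis
      moreover have "A' \<subseteq> U" "B' \<subseteq> U" using * SU by blast+
      ultimately show "incomparable A B" unfolding *(3,4) incomparable_def by blast
    qed
    ultimately show "(-) U ` S \<in> antichains {B \<in> F. M \<subset> B} t"
      by (simp add: antichains_def)
  qed
  show "finite (antichains {B \<in> F. M \<subset> B} t)"
    using finite_subset[OF assms(2)] assms(1) by (intro finite_antichains) simp
qed

section \<open>Copies assembled from a middle element and two antichains\<close>

lemma union_in_induced_copies:
  assumes "finite F" "M \<in> F" "S \<in> antichains {B \<in> F. B \<subset> M} s" "T \<in> antichains {B \<in> F. M \<subset> B} t"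
  shows "insert M (S \<union> T) \<in> induced_copies (K_carrier s t) (K_order s t) F"
proof -
  have S: "S \<subseteq> F" "\<And>A. A \<in> S \<Longrightarrow> A \<subset> M" "card S = s" "pairwise incomparable S"
    and T: "T \<subseteq> F" "\<And>B. B \<in> T \<Longrightarrow> M \<subset> B" "card T = t" "pairwise incomparable T"
    using assms by (auto simp: antichains_def)
  have "finite S" "finite T"
    using finite_subset[OF S(1) assms(1)] finite_subset[OF T(1) assms(1)] by auto
  then obtain f g where f: "bij_betw f {1..s} S" and g: "bij_betw g {1..t} T"
    using ex_bij_betw_nat_finite_1[of S] ex_bij_betw_nat_finite_1[of T]
    unfolding S(3) T(3) by blast
  define h where "h p = (case p of Bot j \<Rightarrow> f j | Mid \<Rightarrow> M | Top j \<Rightarrow> g j)" for p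
  have fS: "f j \<in> S" if "j \<in> {1..s}" for j using bij_betwE[OF f] that by blast
  have gT: "g j \<in> T" if "j \<in> {1..t}" for j using bij_betwE[OF g] that by blast
  have eq_iff: "u i \<subseteq> u j \<longleftrightarrow> i = j"
    if "bij_betw u I X" "pairwise incomparable X" "i \<in> I" "j \<in> I" for u X i j and I :: "nat set"
  proof
    assume sub: "u i \<subseteq> u j"
    have "u i \<in> X" "u j \<in> X" using bij_betwE[OF that(1)] that(3,4) by blast+
    with sub that(2) have "u i = u j" unfolding pairwise_def incomparable_def by blast
    then show "i = j" using bij_betw_imp_inj_on[OF that(1)] that(3,4) by (blast dest: inj_onD)
  qed simp
  note ff = eq_iff[OF f S(4)] and gg = eq_iff[OF g T(4)]
  have fM: "f j \<subseteq> M" "\<not> M \<subseteq> f j" if "j \<in> {1..s}" for j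
    using S(2)[OF fS[OF that]] by blast+
  have gM: "M \<subseteq> g j" "\<not> g j \<subseteq> M" if "j \<in> {1..t}" for j
    using T(2)[OF gT[OF that]] by blast+
  have fg: "f i \<subseteq> g j" "\<not> g j \<subseteq> f i" if "i \<in> {1..s}" "j \<in> {1..t}" for i j
    using fM[OF that(1)] gM[OF that(2)] by blast+
  have mem: "Bot i \<in> K_carrier s t \<longleftrightarrow> i \<in> {1..s}" "Mid \<in> K_carrier s t"
    "Top i \<in> K_carrier s t \<longleftrightarrow> i \<in> {1..t}" for i
    by (auto simp: K_carrier_def)
  have order: "(p, q) \<in> K_order s t \<longleftrightarrow> h p \<subseteq> h q"
    if "p \<in> K_carrier s t" "q \<in> K_carrier s t" for p q
    using that by (cases p; cases q)
      (simp_all add: K_order_def h_def mem ff gg fM gM fg del: atLeastAtMost_iff)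
  \<comment> \<open>Equal images are included in each other, so injectivity follows from
    \<open>order\<close> and antisymmetry of \<open>K_order\<close>.\<close>
  have "inj_on h (K_carrier s t)"
  proof (rule inj_onI)
    fix p q assume *: "p \<in> K_carrier s t" "q \<in> K_carrier s t" "h p = h q"
    then have "(p, q) \<in> K_order s t" "(q, p) \<in> K_order s t" using order by auto
    then show "p = q"
      using partial_order_on_K[of s t] by (auto simp: partial_order_on_def antisym_def)
  qed
  moreover have "h ` K_carrier s t = insert M (S \<union> T)"
  proof -
    have "h ` K_carrier s t = f ` {1..s} \<union> {M} \<union> g ` {1..t}"
      unfolding K_carrier_def image_Un image_image by (simp add: h_def)
    then show ?thesis using f g by (auto simp: bij_betw_def)
  qed
  ultimately have "bij_betw h (K_carrier s t) (insert M (S \<union> T))"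
    by (simp add: bij_betw_def)
  with order show ?thesis
    unfolding induced_copies_def using S(1) T(1) assms(2) by auto
qed

text \<open>The middle element of a copy is its only member with exactly \<open>s\<close> members strictly below it,
  so a copy determines its three parts.\<close>

lemma inj_on_union:
  assumes "finite F"
  shows "inj_on (\<lambda>(M, S, T). insert M (S \<union> T))
    (SIGMA M:F. antichains {B \<in> F. B \<subset> M} s \<times> antichains {B \<in> F. M \<subset> B} t)"
proof -
  define G where "G M S T = insert M (S \<union> T)" for M :: "'a set" and S T
  let ?P = "\<lambda>M S T. S \<in> antichains {B \<in> F. B \<subset> M} s \<and> T \<in> antichains {B \<in> F. M \<subset> B} t"
  have parts: "{Y \<in> G M S T. Y \<subset> M} = S" "{Y \<in> G M S T. M \<subset> Y} = T" if "?P M S T" for M S T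
    using that by (auto simp: antichains_def G_def)
  have unique: "X = M" if P: "?P M S T" and X: "X \<in> G M S T" "card {Y \<in> G M S T. Y \<subset> X} = s" for M S T X
  proof (rule ccontr)
    assume "X \<noteq> M"
    have fin: "finite S" "finite T" using P assms by (auto simp: antichains_def intro: finite_subset)
    have "card S = s" using P by (auto simp: antichains_def)
    \<comment> \<open>A set in \<open>S\<close> has no member of the copy strictly below it,
      although \<open>S\<close> being nonempty forces \<open>s > 0\<close>; a set in
      \<open>T\<close> has \<open>M\<close> and all of \<open>S\<close> below it, hence at least
      \<open>s + 1\<close> members.\<close>
    from X \<open>X \<noteq> M\<close> consider "X \<in> S" | "X \<in> T" by (auto simp: G_def)
    then show False
    proof cases
      case 1
      have "\<not> Y \<subset> X" if "Y \<in> G M S T" for Y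
      proof
        assume "Y \<subset> X"
        moreover have "X \<subset> M" "\<And>B. B \<in> T \<Longrightarrow> M \<subset> B" using 1 P by (auto simp: antichains_def)
        ultimately have "Y \<in> S" using that by (auto simp: G_def)
        with 1 P \<open>Y \<subset> X\<close> show False
          by (auto simp: antichains_def pairwise_def incomparable_def)
      qed
      then have "{Y \<in> G M S T. Y \<subset> X} = {}" by auto
      with X have "s = 0" by simp
      with \<open>card S = s\<close> fin 1 show False by auto
    next
      case 2
      have "insert M S \<subseteq> {Y \<in> G M S T. Y \<subset> X}"
        using 2 P by (auto simp: antichains_def G_def)
      then have "card (insert M S) \<le> card {Y \<in> G M S T. Y \<subset> X}"
        using fin by (intro card_mono) (auto simp: G_def)
      moreover have "M \<notin> S" using P by (auto simp: antichains_def)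
      ultimately show False using X \<open>card S = s\<close> fin by simp
    qed
  qed
  show ?thesis
  proof (rule inj_onI)
    fix x y
    assume "x \<in> (SIGMA M:F. antichains {B \<in> F. B \<subset> M} s \<times> antichains {B \<in> F. M \<subset> B} t)"
      "y \<in> (SIGMA M:F. antichains {B \<in> F. B \<subset> M} s \<times> antichains {B \<in> F. M \<subset> B} t)"
      and un: "(\<lambda>(M, S, T). insert M (S \<union> T)) x = (\<lambda>(M, S, T). insert M (S \<union> T)) y"
    then obtain M S T M' S' T' where xy: "x = (M, S, T)" "y = (M', S', T')" and P: "S \<in> antichains {B \<in> F. B \<subset> M} s" "T \<in> antichains {B \<in> F. M \<subset> B} t"
      "S' \<in> antichains {B \<in> F. B \<subset> M'} s" "T' \<in> antichains {B \<in> F. M' \<subset> B} t"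
      by auto
    have eq: "G M S T = G M' S' T'" using un by (simp add: G_def xy)
    have "M' = M"
    proof (rule unique)
      show "M' \<in> G M S T" by (simp add: eq) (simp add: G_def)
      show "card {Y \<in> G M S T. Y \<subset> M'} = s"
        using parts(1)[of S' M' T'] P unfolding eq by (simp add: antichains_def)
    qed (use P in simp)
    moreover have "S' = S" "T' = T"
      using parts[of S M T] parts[of S' M' T'] P eq \<open>M' = M\<close> by simp_all
    ultimately show "x = y" by (simp add: xy)
  qed
qed

text \<open>Restricting the middles to \<open>G\<close> allows counting at good members only, while
  the antichains still come from all of \<open>F\<close>.\<close>

lemma card_induced_copies_ge:
  assumes "finite F" "G \<subseteq> F"
  shows "(\<Sum>M\<in>G. card (antichains {B \<in> F. B \<subset> M} s) * card (antichains {B \<in> F. M \<subset> B} t))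
    \<le> card (induced_copies (K_carrier s t) (K_order s t) F)"
proof -
  let ?X = "SIGMA M:G. antichains {B \<in> F. B \<subset> M} s \<times> antichains {B \<in> F. M \<subset> B} t"
  have fin: "finite (antichains {B \<in> F. Q B} j)" for Q j
    using assms(1) by (intro finite_antichains) auto
  have "finite G" using assms finite_subset by auto
  then have "card ?X = (\<Sum>M\<in>G. card (antichains {B \<in> F. B \<subset> M} s \<times> antichains {B \<in> F. M \<subset> B} t))"
    by (intro card_SigmaI ballI finite_cartesian_product fin)
  then have "(\<Sum>M\<in>G. card (antichains {B \<in> F. B \<subset> M} s) * card (antichains {B \<in> F. M \<subset> B} t)) = card ?X"
    by (simp only: card_cartesian_product)
  also have "\<dots> \<le> card (induced_copies (K_carrier s t) (K_order s t) F)"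
  proof (rule card_inj_on_le)
    show "inj_on (\<lambda>(M, S, T). insert M (S \<union> T)) ?X"
      by (rule inj_on_subset[OF inj_on_union[OF assms(1)] Sigma_mono[OF assms(2) order.refl]])
    show "(\<lambda>(M, S, T). insert M (S \<union> T)) ` ?X \<subseteq> induced_copies (K_carrier s t) (K_order s t) F"
    proof (rule image_subsetI)
      fix z assume zX: "z \<in> ?X"
      obtain M S T where z: "z = (M, S, T)" by (rule prod_cases3)
      with zX have M: "M \<in> G"
        and ST: "S \<in> antichains {B \<in> F. B \<subset> M} s" "T \<in> antichains {B \<in> F. M \<subset> B} t"
        by simp_all
      from M assms(2) have "M \<in> F" by (rule rev_subsetD)
      with ST show "(\<lambda>(M, S, T). insert M (S \<union> T)) z
          \<in> induced_copies (K_carrier s t) (K_order s t) F"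
        unfolding z prod.case by (intro union_in_induced_copies assms(1))
    qed
    show "finite (induced_copies (K_carrier s t) (K_order s t) F)"
    proof (rule finite_subset)
      show "induced_copies (K_carrier s t) (K_order s t) F \<subseteq> Pow F"
        unfolding induced_copies_def by blast
    qed (use assms(1) in simp)
  qed
  finally show ?thesis .
qed

section \<open>Few sets have size far below the middle\<close>

lemma card_small_subsets:
  assumes "finite U"
  shows "card {A \<in> Pow U. card A < k} = (\<Sum>j<k. card U choose j)"
proof -
  have "{A \<in> Pow U. card A < k} = (\<Union>j\<in>{..<k}. {A. A \<subseteq> U \<and> card A = j})" by auto
  also have "card \<dots> = (\<Sum>j<k. card {A. A \<subseteq> U \<and> card A = j})"
    using assms by (intro card_UN_disjoint) auto
  finally show ?thesis using assms by (simp add: n_subsets)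
qed

text \<open>Hoeffding's inequality for the binomial distribution with parameter 1/2. The
  \<open>+ 1\<close> leaves room for rounding \<open>k\<close> up: every \<open>j < k\<close> still
  lies below the threshold.\<close>

lemma binomial_lower_tail:
  assumes "0 < n" "0 \<le> \<gamma>" "real k \<le> (1 / 2 - \<gamma>) * real n + 1"
  shows "real (\<Sum>j<k. n choose j) \<le> exp (-2 * real n * \<gamma>\<^sup>2) * 2 ^ n"
proof -
  interpret binomial_distribution n "1 / 2" by unfold_locales auto
  let ?p = "binomial_pmf n (1 / 2)"
  have le: "real j \<le> (1 / 2 - \<gamma>) * real n" if "j < k" for j
    using that assms(3) by linarith
  have "real (\<Sum>j<k. n choose j) / 2 ^ n = (\<Sum>j<k. pmf ?p j)"
    unfolding of_nat_sum sum_divide_distrib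
  proof (intro sum.cong refl)
    fix j assume "j \<in> {..<k}"
    then have "real j \<le> (1 / 2 - \<gamma>) * real n" using le by auto
    also have "\<dots> \<le> 1 * real n" using assms by (intro mult_right_mono) auto
    finally have "j \<le> n" by simp
    then have "((1::real) / 2) ^ j * (1 / 2) ^ (n - j) = (1 / 2) ^ n"
      by (simp flip: power_add)
    then show "real (n choose j) / 2 ^ n = pmf ?p j"
      by (simp add: power_one_over field_simps)
  qed
  also have "\<dots> = measure_pmf.prob ?p {..<k}" by (simp add: measure_measure_pmf_finite)
  also have "\<dots> \<le> measure_pmf.prob ?p {x. real x / real n \<le> 1 / 2 - \<gamma>}"
    using le assms by (intro measure_pmf.finite_measure_mono) (auto simp: field_simps)
  also have "\<dots> \<le> exp (-2 * real n * \<gamma>\<^sup>2)"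
    using prob_le'[of \<gamma>] assms by simp
  finally show ?thesis by (simp add: field_simps)
qed

lemma two_power_le_central_binomial: "2 ^ n \<le> Suc n * (n choose (n div 2))"
proof -
  have "2 ^ n = (\<Sum>j\<le>n. n choose j)" by (simp add: choose_row_sum)
  also have "\<dots> \<le> card {..n} * (n choose (n div 2))"
    using sum_bounded_above[of "{..n}" "\<lambda>j. n choose j"] binomial_maximum by simp
  finally show ?thesis by simp
qed

text \<open>The tail decays exponentially relative to \<open>2 ^ n\<close>, which exceeds the
  central binomial coefficient by a factor of at most \<open>n + 1\<close>. The threshold for
  \<open>n\<close> is uniform in \<open>k\<close>.\<close>

lemma eventually_few_small_subsets:
  assumes "0 < \<gamma>" "0 < \<epsilon>"
  shows "\<forall>\<^sub>F n in sequentially. \<forall>k. real k \<le> (1 / 2 - \<gamma>) * real n + 1 \<longrightarrow>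
    real (\<Sum>j<k. n choose j) \<le> \<epsilon> * real (n choose (n div 2))"
proof -
  have "(\<lambda>n. real (Suc n) * exp (-2 * real n * \<gamma>\<^sup>2)) \<longlonglongrightarrow> 0"
    using assms(1) by real_asymp
  then have "\<forall>\<^sub>F n in sequentially. real (Suc n) * exp (-2 * real n * \<gamma>\<^sup>2) < \<epsilon>"
    using assms(2) by (rule order_tendstoD)
  then show ?thesis
    using eventually_gt_at_top[of 0]
  proof eventually_elim
    case (elim n)
    show ?case
    proof (intro allI impI)
      fix k assume "real k \<le> (1 / 2 - \<gamma>) * real n + 1"
      then have "real (\<Sum>j<k. n choose j) \<le> exp (-2 * real n * \<gamma>\<^sup>2) * 2 ^ n"
        using elim assms by (intro binomial_lower_tail) auto
      also have "(2::real) ^ n \<le> real (Suc n) * real (n choose (n div 2))"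
        using two_power_le_central_binomial[of n] by (metis of_nat_le_iff of_nat_mult of_nat_numeral of_nat_power)
      finally have "real (\<Sum>j<k. n choose j)
          \<le> (real (Suc n) * exp (-2 * real n * \<gamma>\<^sup>2)) * real (n choose (n div 2))"
        by (simp add: mult_ac)
      also have "\<dots> \<le> \<epsilon> * real (n choose (n div 2))"
        using elim by (intro mult_right_mono) auto
      finally show "real (\<Sum>j<k. n choose j) \<le> \<epsilon> * real (n choose (n div 2))" .
    qed
  qed
qed

section \<open>Counting copies at the good members\<close>

lemma supersaturation_at:
  fixes F :: "'a set set" and k s t :: nat and \<eta> \<epsilon> :: real
  defines "C n \<equiv> real (n choose (n div 2))"
  assumes U: "finite U" "F \<subseteq> Pow U" and "0 < k"
    and \<eta>: "0 < \<eta>" "\<eta> \<le> 1 / 2" "16 * \<eta> \<le> \<epsilon>"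
    and thin: "4 * real (s + t) * real (card U - 2 * k) \<le> \<eta> * real k"
    and few: "real (\<Sum>j<k. card U choose j) \<le> \<epsilon> / 4 * C (card U)"
    and large: "(2 + \<epsilon>) * C (card U) \<le> real (card F)"
  shows "\<epsilon> / 4 * C (card U) * (\<eta> * real k / 2) ^ (s + t)
    \<le> fact s * fact t * real (card (induced_copies (K_carrier s t) (K_order s t) F))"
proof -
  let ?C = "C (card U)" and ?c = "(-) U"
  define L where "L = {A \<in> Pow U. card A < k}"
  define H where "H = {A \<in> F. k \<le> card A \<and> k \<le> card (U - A)}"
  define X where "X = {M \<in> H. hit_prob (H - {M}) M \<le> \<eta>}"
  \<comment> \<open>These are the members bad from above: a chain ascending from \<open>M\<close>
    becomes a chain descending from \<open>U - M\<close> in the complemented family.\<close>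
  define Y where "Y = {M \<in> H. hit_prob (?c ` H - {U - M}) (U - M) \<le> \<eta>}"
  define G where "G = H - X - Y"
  have finF: "finite F" using U by (meson finite_Pow_iff finite_subset)
  then have finH: "finite H" by (simp add: H_def)
  have HU: "H \<subseteq> Pow U" using U by (auto simp: H_def)
  have inj: "inj_on ?c (Pow U)"
    by (rule inj_on_inverseI[where g = ?c]) (simp add: double_diff)

  have "finite L" using U by (simp add: L_def)
  \<comment> \<open>A discarded member either is too small or has a complement that is too
    small.\<close>
  have "F \<subseteq> H \<union> (L \<union> ?c ` L)"
  proof
    fix A assume "A \<in> F"
    then have "A \<subseteq> U" using U by blast
    then have "A = ?c (U - A)" by (simp add: double_diff)
    with \<open>A \<in> F\<close> \<open>A \<subseteq> U\<close> show "A \<in> H \<union> (L \<union> ?c ` L)"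
      by (cases "card (U - A) < k") (auto simp: H_def L_def image_iff intro: exI[of _ "U - A"])
  qed
  then have "card F \<le> card (H \<union> (L \<union> ?c ` L))"
    using finH \<open>finite L\<close> by (intro card_mono) auto
  also have "\<dots> \<le> card H + (card L + card (?c ` L))"
    by (intro order.trans[OF card_Un_le] add_left_mono card_Un_le)
  also have "card (?c ` L) \<le> card L" using \<open>finite L\<close> by (rule card_image_le)
  finally have "real (card F) \<le> real (card H) + 2 * real (card L)" by simp
  moreover have "real (card L) \<le> \<epsilon> / 4 * ?C"
    using few card_small_subsets[OF U(1), of k] by (simp add: L_def)
  ultimately have cardH: "(2 + \<epsilon> / 2) * ?C \<le> real (card H)"
    using large by (simp add: algebra_simps)

  have X: "(1 - \<eta>) * real (card X) \<le> ?C"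
    unfolding X_def C_def by (rule card_bad_le[OF U(1) HU])
  have "?c ` Y = {M \<in> ?c ` H. hit_prob (?c ` H - {M}) M \<le> \<eta>}" by (auto simp: Y_def)
  moreover have "?c ` H \<subseteq> Pow U" by blast
  ultimately have "(1 - \<eta>) * real (card (?c ` Y)) \<le> ?C"
    unfolding C_def using card_bad_le[OF U(1)] by simp
  moreover have "card (?c ` Y) = card Y"
    using HU by (intro card_image inj_on_subset[OF inj]) (auto simp: Y_def)
  ultimately have Y: "(1 - \<eta>) * real (card Y) \<le> ?C" by simp
  have "0 \<le> ?C" by (simp add: C_def)
  have bad: "real m \<le> (1 + 2 * \<eta>) * ?C" if "(1 - \<eta>) * real m \<le> ?C" for m
  proof -
    \<comment> \<open>The right side exceeds 1 by \<open>\<eta> * (1 - 2 * \<eta>)\<close>, which is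
      where \<open>\<eta> \<le> 1 / 2\<close> enters.\<close>
    have "1 \<le> (1 + 2 * \<eta>) * (1 - \<eta>)"
      using mult_nonneg_nonneg[of \<eta> "1 - 2 * \<eta>"] \<eta> by (simp add: algebra_simps)
    then have "1 * real m \<le> (1 + 2 * \<eta>) * (1 - \<eta>) * real m"
      by (rule mult_right_mono) simp
    also have "\<dots> \<le> (1 + 2 * \<eta>) * ?C"
      unfolding mult.assoc using that \<eta> by (intro mult_left_mono) auto
    finally show ?thesis by simp
  qed
  have "real (card H) \<le> real (card G) + real (card X) + real (card Y)"
  proof -
    have "H \<subseteq> G \<union> X \<union> Y" by (auto simp: G_def)
    then have "card H \<le> card (G \<union> X \<union> Y)"
      using finH by (intro card_mono) (auto simp: G_def X_def Y_def)
    also have "\<dots> \<le> card G + card X + card Y"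
      by (intro order.trans[OF card_Un_le] add_right_mono card_Un_le)
    finally show ?thesis by linarith
  qed
  \<comment> \<open>The two bad families cost at most \<open>2 + 4 * \<eta>\<close> central binomial
    coefficients; as \<open>16 * \<eta> \<le> \<epsilon>\<close>, a surplus of
    \<open>\<epsilon> / 4\<close> remains.\<close>
  then have "(2 + \<epsilon> / 2) * ?C \<le> real (card G) + 2 * ((1 + 2 * \<eta>) * ?C)"
    using cardH bad[OF X] bad[OF Y] by linarith
  moreover have "4 * \<eta> * ?C \<le> \<epsilon> / 4 * ?C"
    using \<eta> \<open>0 \<le> ?C\<close> by (intro mult_right_mono) auto
  ultimately have cardG: "\<epsilon> / 4 * ?C \<le> real (card G)" by (simp add: algebra_simps)

  let ?a = "\<lambda>M. card (antichains {B \<in> H. B \<subset> M} s)" and ?b = "\<lambda>M. card (antichains {B \<in> H. M \<subset> B} t)"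
  let ?x = "\<eta> * real k / 2"
  \<comment> \<open>All sizes lie between \<open>k\<close> and \<open>card U - k\<close>, so
    \<open>card M - k\<close> is at most the window width \<open>card U - 2 * k\<close>. This serves
    both \<open>M\<close> and \<open>U - M\<close>.\<close>
  have thin': "4 * real j * real (card M - k) \<le> \<eta> * real (card M)"
    if "k \<le> card M" "card M \<le> card U - k" "j \<le> s + t" for j and M :: "'a set"
  proof -
    have "4 * real j * real (card M - k) \<le> 4 * real (s + t) * real (card U - 2 * k)"
      using that by (intro mult_mono) auto
    also have "\<dots> \<le> \<eta> * real (card M)"
      using thin that(1) \<eta> by (elim order.trans) (intro mult_left_mono, auto)
    finally show ?thesis .
  qed
  have each: "?x ^ (s + t) \<le> fact s * fact t * (real (?a M) * real (?b M))" if "M \<in> G" for M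
  proof -
    have M: "M \<in> H" "M \<notin> X" "M \<notin> Y" using that by (auto simp: G_def)
    then have MU: "M \<subseteq> U" and kM: "k \<le> card M" "k \<le> card (U - M)" using HU by (auto simp: H_def)
    have finM: "finite M" "finite (U - M)" using MU U finite_subset by auto
    have "card (U - M) = card U - card M" "card M \<le> card U"
      using MU U finM by (simp_all add: card_Diff_subset card_mono)
    with kM have size: "card M \<le> card U - k" "card (U - M) \<le> card U - k" by auto
    have "?x ^ s \<le> (\<eta> * real (card M) / 2) ^ s"
      using kM \<eta> by (intro power_mono divide_right_mono mult_left_mono) auto
    also have "\<dots> \<le> fact s * real (?a M)"
      using M kM size \<eta> \<open>0 < k\<close> finM
      by (intro many_antichains_below[where k = k] thin') (auto simp: X_def H_def)
    finally have a: "?x ^ s \<le> fact s * real (?a M)" .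
    have "?x ^ t \<le> (\<eta> * real (card (U - M)) / 2) ^ t"
      using kM \<eta> by (intro power_mono divide_right_mono mult_left_mono) auto
    also have "\<dots> \<le> fact t * real (card (antichains {B \<in> ?c ` H. B \<subset> U - M} t))"
      using M kM size \<eta> \<open>0 < k\<close> finM
      by (intro many_antichains_below[where k = k] thin') (auto simp: Y_def H_def)
    also have "\<dots> \<le> fact t * real (?b M)"
      using card_antichains_complement[OF U(1) HU MU] by (intro mult_left_mono) auto
    finally have b: "?x ^ t \<le> fact t * real (?b M)" .
    have "?x ^ s * ?x ^ t \<le> (fact s * real (?a M)) * (fact t * real (?b M))"
      using a b \<eta> by (intro mult_mono) auto
    then show ?thesis by (simp add: power_add mult_ac)
  qed
  have "\<epsilon> / 4 * ?C * ?x ^ (s + t) \<le> real (card G) * ?x ^ (s + t)"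
    using cardG \<eta> by (intro mult_right_mono) auto
  also have "\<dots> \<le> (\<Sum>M\<in>G. fact s * fact t * (real (?a M) * real (?b M)))"
    by (intro sum_bounded_below each)
  also have "\<dots> = fact s * fact t * real (\<Sum>M\<in>G. ?a M * ?b M)"
    by (simp add: sum_distrib_left)
  also have "\<dots> \<le> fact s * fact t * real (card (induced_copies (K_carrier s t) (K_order s t) H))"
    using card_induced_copies_ge[OF finH, of G s t]
    by (intro mult_left_mono of_nat_mono) (auto simp: G_def)
  also have "card (induced_copies (K_carrier s t) (K_order s t) H)
      \<le> card (induced_copies (K_carrier s t) (K_order s t) F)"
  proof (rule card_mono)
    have "induced_copies (K_carrier s t) (K_order s t) F \<subseteq> Pow F"
      unfolding induced_copies_def by blast
    then show "finite (induced_copies (K_carrier s t) (K_order s t) F)"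
      by (rule finite_subset) (simp add: finF)
    have "H \<subseteq> F" by (auto simp: H_def)
    then show "induced_copies (K_carrier s t) (K_order s t) H
        \<subseteq> induced_copies (K_carrier s t) (K_order s t) F"
      unfolding induced_copies_def by blast
  qed
  finally show ?thesis by simp
qed

theorem theorem1p7:
  fixes s t :: nat and \<epsilon> :: real
  assumes "\<epsilon> > 0"
  shows "\<exists>(n0::nat) (\<delta>::real). \<delta> > 0 \<and>
    (\<forall>n\<ge>n0. \<forall>F :: nat set set. F \<subseteq> Pow {1..n} \<longrightarrow>
       real (card F) \<ge> (2 + \<epsilon>) * real (n choose (n div 2)) \<longrightarrow>
       real (card (induced_copies (K_carrier s t) (K_order s t) F))
         \<ge> \<delta> * real n ^ (s + t) * real (n choose (n div 2)))"
proof -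
  define \<eta> where "\<eta> = min (1 / 2) (\<epsilon> / 16)"
  \<comment> \<open>Chosen so that a window of width at most \<open>2 * \<gamma> * n\<close>
    satisfies the thinness condition with \<open>k \<ge> n / 4\<close>. The \<open>+ 1\<close> keeps
    the denominator positive when \<open>s + t = 0\<close>.\<close>
  define \<gamma> where "\<gamma> = \<eta> / (32 * (real (s + t) + 1))"
  \<comment> \<open>The factor \<open>\<eta> / 8\<close> is \<open>\<eta> / 2\<close> combined with
    \<open>k \<ge> n / 4\<close>.\<close>
  define \<delta> where "\<delta> = \<epsilon> / 4 * (\<eta> / 8) ^ (s + t) / (fact s * fact t)"
  have \<eta>: "0 < \<eta>" "\<eta> \<le> 1 / 2" "16 * \<eta> \<le> \<epsilon>" using assms by (auto simp: \<eta>_def)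
  have \<gamma>: "0 < \<gamma>" using \<eta> by (simp add: \<gamma>_def)
  have \<gamma>_bound: "32 * (real (s + t) + 1) * \<gamma> = \<eta>"
    by (simp add: \<gamma>_def field_simps add_nonneg_eq_0_iff)
  have "\<gamma> \<le> 1 / 4"
  proof -
    have "32 * 1 * \<gamma> \<le> 32 * (real (s + t) + 1) * \<gamma>"
      using \<gamma> by (intro mult_right_mono mult_left_mono) auto
    then show ?thesis using \<gamma>_bound \<eta> by simp
  qed
  have "0 < \<epsilon> / 4" using assms by simp
  from eventually_few_small_subsets[OF \<gamma> this] obtain n0 where n0:
    "\<And>n k. n \<ge> n0 \<Longrightarrow> real k \<le> (1 / 2 - \<gamma>) * real n + 1 \<Longrightarrow>
      real (\<Sum>j<k. n choose j) \<le> \<epsilon> / 4 * real (n choose (n div 2))"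
    unfolding eventually_sequentially by blast
  have main: "\<delta> * real n ^ (s + t) * real (n choose (n div 2))
      \<le> real (card (induced_copies (K_carrier s t) (K_order s t) F))"
    if n: "n \<ge> max 1 n0" and F: "F \<subseteq> Pow {1..n}" "(2 + \<epsilon>) * real (n choose (n div 2)) \<le> real (card F)"
    for n and F :: "nat set set"
  proof -
    \<comment> \<open>Rounding up keeps \<open>n - 2 * k\<close> at most
      \<open>2 * \<gamma> * n\<close>, while the excess of less than 1 fits the \<open>+ 1\<close>
      in the tail bound.\<close>
    define k where "k = nat \<lceil>(1 / 2 - \<gamma>) * real n\<rceil>"
    let ?C = "real (n choose (n div 2))"
    let ?N = "real (card (induced_copies (K_carrier s t) (K_order s t) F))"
    have pos: "0 < (1 / 2 - \<gamma>) * real n" using n \<open>\<gamma> \<le> 1 / 4\<close> by (intro mult_pos_pos) auto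
    have k: "(1 / 2 - \<gamma>) * real n \<le> real k" "real k \<le> (1 / 2 - \<gamma>) * real n + 1"
      using pos unfolding k_def by linarith+
    have "1 / 4 * real n \<le> (1 / 2 - \<gamma>) * real n"
      using \<open>\<gamma> \<le> 1 / 4\<close> by (intro mult_right_mono) auto
    with k have quarter: "real n / 4 \<le> real k" by simp
    have "real (n - 2 * k) \<le> 2 * \<gamma> * real n"
    proof (cases "n \<le> 2 * k")
      case False
      with k show ?thesis by (simp add: of_nat_diff algebra_simps)
    qed (use \<gamma> in simp)
    then have "4 * real (s + t) * real (n - 2 * k) \<le> 4 * real (s + t) * (2 * \<gamma> * real n)"
      by (intro mult_left_mono) auto
    also have "\<dots> \<le> (32 * (real (s + t) + 1) * \<gamma>) * (real n / 4)"
      using \<gamma> by (simp add: algebra_simps)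
    also have "\<dots> \<le> \<eta> * real k"
      unfolding \<gamma>_bound using quarter \<eta> by (intro mult_left_mono) auto
    finally have thin: "4 * real (s + t) * real (n - 2 * k) \<le> \<eta> * real k" .
    have "\<epsilon> / 4 * ?C * (\<eta> * real k / 2) ^ (s + t) \<le> fact s * fact t * ?N"
    proof -
      have "0 < k" using pos k(1) by linarith
      then show ?thesis
        using supersaturation_at[of "{1..n}" F k \<eta> \<epsilon> s t] F \<eta> thin n0[of n k] n k(2) by simp
    qed
    moreover have "\<epsilon> / 4 * ?C * (\<eta> * real n / 8) ^ (s + t) \<le> \<epsilon> / 4 * ?C * (\<eta> * real k / 2) ^ (s + t)"
    proof (intro mult_left_mono power_mono)
      show "\<eta> * real n / 8 \<le> \<eta> * real k / 2"
        using mult_left_mono[OF quarter, of \<eta>] \<eta> by simp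
    qed (use \<eta> assms in auto)
    ultimately have "\<epsilon> / 4 * ?C * (\<eta> * real n / 8) ^ (s + t) \<le> fact s * fact t * ?N"
      by linarith
    then have "\<epsilon> / 4 * ?C * (\<eta> * real n / 8) ^ (s + t) / (fact s * fact t) \<le> ?N"
      by (simp add: divide_le_eq mult_ac)
    moreover have "\<delta> * real n ^ (s + t) * ?C = \<epsilon> / 4 * ?C * (\<eta> * real n / 8) ^ (s + t) / (fact s * fact t)"
      by (simp add: \<delta>_def power_mult_distrib power_divide)
    ultimately show ?thesis by simp
  qed
  have "0 < \<delta>" using \<eta> assms by (simp add: \<delta>_def)
  with main show ?thesis by blast
qed

end
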